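(* Let $C\subseteq\mathbb{F}_q^n$ be an $[n,k]$ code over $\mathbb{F}_q$ and let $r$ be a positive integer with $r\le k$. Suppose that for every integer $j$ with $d_r(C)\le j\le n$ the multiset $\mathcal{S}_{r,j}(C)$ forms a $1$-design. Then for any coordinate place $i\in[n]$, $$J_{C,\{i\}}^{(r)}=\frac1n\,A\,W_C^{(r)},$$ that is, $J_{C,\{i\}}^{(r)}(w,z,x,y)=\frac1n\left(w\,\frac{\partial}{\partial x}+z\,\frac{\partial}{\partial y}\right)W_C^{(r)}(x,y)$.
   Context: $q$ is a prime power, $[n]=\{1,\dots,n\}$, and $\overline{T}=[n]\setminus T$ for $T\subseteq[n]$. An $[n,k]$ code over $\mathbb{F}_q$ is a $k$-dimensional $\mathbb{F}_q$-linear subspace $C$ of $\mathbb{F}_q^n$. For a linear subspace $D\subseteq\mathbb{F}_q^n$, $\mathrm{Supp}(D)=\{i\in[n] : u_i\ne 0\text{ for some }u\in D\}$, $\mathrm{wt}(D)=|\mathrm{Supp}(D)|$, and $\mathrm{wt}_S(D)=|\mathrm{Supp}(D)\cap S|$ for $S\subseteq[n]$. $\mathcal{D}_r(C)$ is the set of $r$-dimensional $\mathbb{F}_q$-subspaces of $C$, and $d_r(C)=\min\{\mathrm{wt}(D) : D\in\mathcal{D}_r(C)\}$. $\mathcal{S}_{r,j}(C)$ is the multiset of supports $\mathrm{Supp}(D)$ of those $D\in\mathcal{D}_r(C)$ with $\mathrm{wt}(D)=j$ (counted with multiplicity). A multiset $\mathcal{B}$ of $j$-subsets of $[n]$ is a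 $1$-design if every element of $[n]$ lies in the same number $\lambda$ of members of $\mathcal{B}$, counted with multiplicity (the empty collection is a $1$-design with $\lambda=0$). The $r$-th higher weight enumerator is $W_C^{(r)}(x,y)=\sum_{i=0}^n A_i^{(r)}(C)x^{n-i}y^i$ with $A_i^{(r)}(C)=\#\{D\in\mathcal{D}_r(C) : \mathrm{wt}(D)=i\}$. The $r$-th higher Jacobi polynomial associated to $T$ is $$J_{C,T}^{(r)}(w,z,x,y)=\sum_{i=0}^{n-|T|}\sum_{j=0}^{|T|}A_{i,j}^{(r)}(C,T)\,w^{|T|-j}z^{j}x^{n-|T|-i}y^{i},$$ where $A_{i,j}^{(r)}(C,T)=\#\{D\in\mathcal{D}_r(C) : \mathrm{wt}_{\overline{T}}(D)=i,\ \mathrm{wt}_T(D)=j\}$. The polarization operator $A$ acts on polynomials $f$ in $w,z,x,y$ by $A f=w\,\frac{\partial f}{\partial x}+z\,\frac{\partial f}{\partial y}$. *)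

theory Defs
  imports "HOL-Analysis.Cartesian_Space" "HOL-Library.Multiset" "HOL-Library.Poly_Mapping"
begin

text \<open>
  The field with \<open>q\<close> elements is an arbitrary type \<open>'a :: {field, finite}\<close> (so \<open>q = CARD('a)\<close>), and the
  coordinate places \<open>[n]\<close> are the elements of an arbitrary finite type \<open>'n\<close> with \<open>n = CARD('n)\<close>.
\<close>

definition linear_code :: "nat \<Rightarrow> ('a::{field,finite} ^ 'n::finite) set \<Rightarrow> bool" where
  "linear_code k C \<longleftrightarrow> vec.subspace C \<and> vec.dim C = k"

definition Supp :: "('a::{field,finite} ^ 'n::finite) set \<Rightarrow> 'n set" where
  "Supp D = {i. \<exists>u\<in>D. u $ i \<noteq> 0}"

definition wt :: "('a::{field,finite} ^ 'n::finite) set \<Rightarrow> nat" where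
  "wt D = card (Supp D)"

definition wt_on :: "'n set \<Rightarrow> ('a::{field,finite} ^ 'n::finite) set \<Rightarrow> nat" where
  "wt_on S D = card (Supp D \<inter> S)"

definition subcodes :: "nat \<Rightarrow> ('a::{field,finite} ^ 'n::finite) set \<Rightarrow> ('a ^ 'n) set set" where
  "subcodes r C = {D. vec.subspace D \<and> D \<subseteq> C \<and> vec.dim D = r}"

definition gen_hamming_weight :: "nat \<Rightarrow> ('a::{field,finite} ^ 'n::finite) set \<Rightarrow> nat" where
  "gen_hamming_weight r C = Min (wt ` subcodes r C)"

definition support_mset :: "nat \<Rightarrow> nat \<Rightarrow> ('a::{field,finite} ^ 'n::finite) set \<Rightarrow> 'n set multiset" where
  "support_mset r j C = image_mset Supp (mset_set {D \<in> subcodes r C. wt D = j})"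

definition one_design :: "nat \<Rightarrow> 'n::finite set multiset \<Rightarrow> bool" where
  "one_design j \<B> \<longleftrightarrow>
     (\<forall>B \<in># \<B>. card B = j) \<and> (\<exists>l. \<forall>p. size {#B \<in># \<B>. p \<in> B#} = l)"

text \<open>
  The polynomial ring in the four indeterminates \<open>w, z, x, y\<close> over the rationals. A polynomial
  maps each exponent vector to its coefficient; the product of \<open>Poly_Mapping\<close> is the
  convolution, that is, polynomial multiplication.
\<close>

datatype indet = Iw | Iz | Ix | Iy

type_synonym poly4 = "(indet \<Rightarrow>\<^sub>0 nat) \<Rightarrow>\<^sub>0 rat"

definition Var :: "indet \<Rightarrow> poly4" where
  "Var v = Poly_Mapping.single (Poly_Mapping.single v 1) 1"

definition Const :: "rat \<Rightarrow> poly4" where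
  "Const c = Poly_Mapping.single 0 c"

text \<open>
  Formal partial derivative. Subtraction of exponents is truncated, but where the exponent of
  \<open>v\<close> is \<open>0\<close> the new coefficient vanishes.
\<close>

definition partial_deriv :: "indet \<Rightarrow> poly4 \<Rightarrow> poly4" where
  "partial_deriv v f =
     (\<Sum>m \<in> Poly_Mapping.keys f.
        Poly_Mapping.single (m - Poly_Mapping.single v 1)
          (of_nat (Poly_Mapping.lookup m v) * Poly_Mapping.lookup f m))"

definition polarization :: "poly4 \<Rightarrow> poly4" where
  "polarization f = Var Iw * partial_deriv Ix f + Var Iz * partial_deriv Iy f"

definition higher_weight_count ::
    "nat \<Rightarrow> ('a::{field,finite} ^ 'n::finite) set \<Rightarrow> nat \<Rightarrow> nat" where
  "higher_weight_count r C i = card {D \<in> subcodes r C. wt D = i}"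

definition higher_weight_enumerator ::
    "nat \<Rightarrow> ('a::{field,finite} ^ 'n::finite) set \<Rightarrow> poly4" where
  "higher_weight_enumerator r C =
     (\<Sum>i = 0..CARD('n). of_nat (higher_weight_count r C i) * Var Ix ^ (CARD('n) - i) * Var Iy ^ i)"

definition higher_jacobi_count ::
    "nat \<Rightarrow> ('a::{field,finite} ^ 'n::finite) set \<Rightarrow> 'n set \<Rightarrow> nat \<Rightarrow> nat \<Rightarrow> nat" where
  "higher_jacobi_count r C T i j = card {D \<in> subcodes r C. wt_on (- T) D = i \<and> wt_on T D = j}"

definition higher_jacobi ::
    "nat \<Rightarrow> ('a::{field,finite} ^ 'n::finite) set \<Rightarrow> 'n set \<Rightarrow> poly4" where
  "higher_jacobi r C T =
     (\<Sum>i = 0..CARD('n) - card T. \<Sum>j = 0..card T.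
        of_nat (higher_jacobi_count r C T i j) *
        Var Iw ^ (card T - j) * Var Iz ^ j * Var Ix ^ (CARD('n) - card T - i) * Var Iy ^ i)"

end

theory Submission imports Defs begin

text \<open>
  Both sides are linear in the numbers of subcodes of each weight, so the identity is compared
  weight by weight. A subcode \<open>D\<close> of weight \<open>j\<close> contributes
  \<open>x\<^sup>n\<^sup>-\<^sup>j y\<^sup>j\<close> to the weight enumerator, and polarization turns this into
  \<open>(n - j) w x\<^sup>n\<^sup>-\<^sup>j\<^sup>-\<^sup>1 y\<^sup>j + j z x\<^sup>n\<^sup>-\<^sup>j y\<^sup>j\<^sup>-\<^sup>1\<close>. To the Jacobi polynomial at the single place
  \<open>i\<close> it contributes the second of these monomials if \<open>i\<close> lies in the support of \<open>D\<close> and the first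
  otherwise, with coefficient one. The coefficients \<open>n - j\<close> and \<open>j\<close> are the numbers of places
  outside and inside the support, so the polarization is the sum of the Jacobi polynomials over all
  places.

  The design hypothesis removes the dependence on the place: double counting pairs of a place and a
  block through it gives \<open>n \<lambda> = j A\<close>, where \<open>A\<close> is the number of subcodes of weight \<open>j\<close> and \<open>\<lambda>\<close>
  the number of those whose support contains \<open>i\<close> (lemma \<open>card_subcodes_through_place\<close>). Below the
  generalized Hamming weight, where the hypothesis is silent, both numbers are zero.
\<close>

text \<open>Counting incident pairs of a point and a block in the two possible orders.\<close>

lemma sum_size_blocks_through_point:
  fixes \<B> :: "'n::finite set multiset"
  shows "(\<Sum>p\<in>UNIV. size {#B \<in># \<B>. p \<in> B#}) = (\<Sum>B\<in>#\<B>. card B)"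
proof (induction \<B>)
  case (add B \<B>)
  have "(\<Sum>p\<in>UNIV. size {#B' \<in># add_mset B \<B>. p \<in> B'#})
      = (\<Sum>p\<in>UNIV. (if p \<in> B then 1 else 0) + size {#B' \<in># \<B>. p \<in> B'#})"
    by (intro sum.cong) auto
  also have "\<dots> = card B + (\<Sum>B\<in>#\<B>. card B)"
    by (simp add: sum.distrib add.IH flip: sum.inter_filter)
  finally show ?case by simp
qed simp

lemma one_design_replication:
  fixes \<B> :: "'n::finite set multiset"
  assumes "one_design j \<B>"
  shows "CARD('n) * size {#B \<in># \<B>. p \<in> B#} = j * size \<B>"
proof -
  obtain l where l: "\<And>p. size {#B \<in># \<B>. p \<in> B#} = l"
    using assms unfolding one_design_def by auto
  have "(\<Sum>B\<in>#\<B>. card B) = (\<Sum>B\<in>#\<B>. j)"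
    using assms unfolding one_design_def by (intro arg_cong[where f = sum_mset] image_mset_cong) auto
  also have "\<dots> = j * size \<B>" by simp
  finally show ?thesis
    using sum_size_blocks_through_point[of \<B>] by (simp add: l)
qed

lemma wt_le: "wt (D :: ('a::{field,finite} ^ 'n::finite) set) \<le> CARD('n)"
  unfolding wt_def by (simp add: card_mono)

lemma card_subcodes_through_place:
  fixes C :: "('a::{field,finite} ^ 'n::finite) set"
  assumes designs: "\<forall>j. gen_hamming_weight r C \<le> j \<and> j \<le> CARD('n)
      \<longrightarrow> one_design j (support_mset r j C)"
  shows "CARD('n) * card {D \<in> subcodes r C. wt D = j \<and> i \<in> Supp D} = j * higher_weight_count r C j"
proof (cases "{D \<in> subcodes r C. wt D = j} = {}")
  case True
  then have "{D \<in> subcodes r C. wt D = j \<and> i \<in> Supp D} = {}" by auto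
  with True show ?thesis by (simp only: higher_weight_count_def card.empty)
next
  case False
  then obtain D where D: "D \<in> subcodes r C" "wt D = j" by auto
  then have "gen_hamming_weight r C \<le> j" unfolding gen_hamming_weight_def by auto
  moreover have "j \<le> CARD('n)" using D wt_le by auto
  ultimately have "one_design j (support_mset r j C)" using designs by auto
  from one_design_replication[OF this, of i] show ?thesis
    by (simp add: support_mset_def higher_weight_count_def filter_mset_image_mset)
qed

text \<open>
  For a single place the Jacobi counts split the subcodes of one weight according to whether that
  place is in the support; it is removed from the weight on the complement if it is.
\<close>

lemma higher_jacobi_count_singleton_1:
  fixes C :: "('a::{field,finite} ^ 'n::finite) set"
  shows "higher_jacobi_count r C {i} a 1 = card {D \<in> subcodes r C. wt D = Suc a \<and> i \<in> Supp D}"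
proof -
  have "wt_on (- {i}) D = a \<and> wt_on {i} D = 1 \<longleftrightarrow> wt D = Suc a \<and> i \<in> Supp D" for D :: "('a ^ 'n) set"
  proof (cases "i \<in> Supp D")
    case True
    have "wt D = Suc (wt_on (- {i}) D)"
      unfolding wt_def wt_on_def Diff_eq[symmetric] using True by (intro card.remove) simp_all
    with True show ?thesis by (auto simp: wt_on_def[of "{i}"])
  qed (simp add: wt_on_def)
  then show ?thesis by (simp add: higher_jacobi_count_def)
qed

lemma higher_jacobi_count_singleton_0:
  fixes C :: "('a::{field,finite} ^ 'n::finite) set"
  shows "higher_jacobi_count r C {i} a 0 + card {D \<in> subcodes r C. wt D = a \<and> i \<in> Supp D}
    = higher_weight_count r C a"
proof -
  have "wt_on (- {i}) D = a \<and> wt_on {i} D = 0 \<longleftrightarrow> wt D = a \<and> i \<notin> Supp D" for D :: "('a ^ 'n) set"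
  proof (cases "i \<in> Supp D")
    case False
    then have "Supp D \<inter> - {i} = Supp D" by blast
    with False show ?thesis by (simp add: wt_on_def wt_def)
  qed (simp add: wt_on_def)
  then have "higher_jacobi_count r C {i} a 0 = card {D \<in> subcodes r C. wt D = a \<and> i \<notin> Supp D}"
    by (simp add: higher_jacobi_count_def)
  also have "\<dots> + card {D \<in> subcodes r C. wt D = a \<and> i \<in> Supp D}
      = card {D \<in> subcodes r C. wt D = a}"
    by (subst card_Un_disjoint[symmetric]) (auto intro!: arg_cong[where f = card])
  finally show ?thesis by (simp add: higher_weight_count_def)
qed

text \<open>
  Summing over any finite set of exponents containing the keys makes the derivative visibly
  additive, since the range of summation no longer depends on the polynomial.
\<close>

lemma partial_deriv_superset:
  assumes "finite S" "Poly_Mapping.keys f \<subseteq> S"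
  shows "partial_deriv v f = (\<Sum>m \<in> S. Poly_Mapping.single (m - Poly_Mapping.single v 1)
          (of_nat (Poly_Mapping.lookup m v) * Poly_Mapping.lookup f m))"
  unfolding partial_deriv_def using assms
  by (intro sum.mono_neutral_left) (auto simp: in_keys_iff)

lemma partial_deriv_add: "partial_deriv v (f + g) = partial_deriv v f + partial_deriv v g"
proof -
  let ?S = "Poly_Mapping.keys f \<union> Poly_Mapping.keys g"
  have "finite ?S" by simp
  moreover have "Poly_Mapping.keys (f + g) \<subseteq> ?S" by (rule Poly_Mapping.keys_add)
  ultimately show ?thesis
    by (simp add: partial_deriv_superset[of ?S] lookup_add distrib_left single_add sum.distrib)
qed

lemma partial_deriv_sum: "partial_deriv v (\<Sum>a\<in>S. f a) = (\<Sum>a\<in>S. partial_deriv v (f a))"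
proof (induction S rule: infinite_finite_induct)
  case (insert a S)
  then show ?case by (simp add: partial_deriv_add)
qed (simp_all add: partial_deriv_def)

lemma partial_deriv_single:
  "partial_deriv v (Poly_Mapping.single m c)
    = Poly_Mapping.single (m - Poly_Mapping.single v 1) (of_nat (Poly_Mapping.lookup m v) * c)"
  by (subst partial_deriv_superset[of "{m}"]) (auto simp: lookup_single)

lemma Var_power: "Var v ^ a = Poly_Mapping.single (Poly_Mapping.single v a) 1"
  by (induction a) (auto simp: Var_def mult_single single_add[symmetric])

lemma monomial_xy:
  "of_nat c * Var Ix ^ a * Var Iy ^ b =
    Poly_Mapping.single (Poly_Mapping.single Ix a + Poly_Mapping.single Iy b) (of_nat c)"
  unfolding Var_power single_of_nat[symmetric] mult_single by simp

lemma partial_deriv_monomial_x: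
  "partial_deriv Ix (of_nat c * Var Ix ^ a * Var Iy ^ b) = of_nat (a * c) * Var Ix ^ (a - 1) * Var Iy ^ b"
proof -
  have "Poly_Mapping.single Ix a + Poly_Mapping.single Iy b - Poly_Mapping.single Ix 1
      = Poly_Mapping.single Ix (a - 1) + Poly_Mapping.single Iy b"
    by (rule poly_mapping_eqI) (auto simp: lookup_minus lookup_add lookup_single when_def)
  then show ?thesis
    unfolding monomial_xy partial_deriv_single by (simp add: lookup_add lookup_single)
qed

lemma partial_deriv_monomial_y:
  "partial_deriv Iy (of_nat c * Var Ix ^ a * Var Iy ^ b) = of_nat (b * c) * Var Ix ^ a * Var Iy ^ (b - 1)"
proof -
  have "Poly_Mapping.single Ix a + Poly_Mapping.single Iy b - Poly_Mapping.single Iy 1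
      = Poly_Mapping.single Ix a + Poly_Mapping.single Iy (b - 1)"
    by (rule poly_mapping_eqI) (auto simp: lookup_minus lookup_add lookup_single when_def)
  then show ?thesis
    unfolding monomial_xy partial_deriv_single by (simp add: lookup_add lookup_single)
qed

lemma polarization_higher_weight_enumerator:
  fixes C :: "('a::{field,finite} ^ 'n::finite) set"
  shows "polarization (higher_weight_enumerator r C) =
    (\<Sum>a = 0..CARD('n) - 1.
      (of_nat ((CARD('n) - a) * higher_weight_count r C a) * Var Iw
        + of_nat (Suc a * higher_weight_count r C (Suc a)) * Var Iz)
      * Var Ix ^ (CARD('n) - 1 - a) * Var Iy ^ a)"
proof -
  define n where "n = CARD('n)"
  define A where "A = higher_weight_count r C"
  obtain m where m: "n = Suc m" unfolding n_def using not0_implies_Suc[of "CARD('n)"] by auto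
  \<comment> \<open>The top term of the \<open>x\<close>-derivative and the bottom term of the \<open>y\<close>-derivative vanish; shifting
      the index of the latter aligns the two.\<close>
  have x: "partial_deriv Ix (higher_weight_enumerator r C)
      = (\<Sum>a = 0..m. of_nat ((n - a) * A a) * Var Ix ^ (m - a) * Var Iy ^ a)"
    unfolding higher_weight_enumerator_def partial_deriv_sum partial_deriv_monomial_x
    by (simp add: m sum.atLeast0_atMost_Suc flip: n_def A_def)
  have y: "partial_deriv Iy (higher_weight_enumerator r C)
      = (\<Sum>a = 0..m. of_nat (Suc a * A (Suc a)) * Var Ix ^ (m - a) * Var Iy ^ a)"
    unfolding higher_weight_enumerator_def partial_deriv_sum partial_deriv_monomial_y
    unfolding n_def[symmetric] A_def[symmetric] m sum.atLeast0_atMost_Suc_shift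
    by (simp del: of_nat_mult of_nat_Suc mult_Suc)
  have "polarization (higher_weight_enumerator r C) = (\<Sum>a = 0..m.
      (of_nat ((n - a) * A a) * Var Iw + of_nat (Suc a * A (Suc a)) * Var Iz)
      * Var Ix ^ (m - a) * Var Iy ^ a)"
    unfolding polarization_def x y sum_distrib_left sum.distrib[symmetric]
    by (intro sum.cong refl) (simp only: distrib_left distrib_right ac_simps)
  then show ?thesis by (simp add: m flip: n_def A_def)
qed

theorem theorem5p2:
  fixes C :: "('a::{field,finite} ^ 'n::finite) set" and k r :: nat and i :: 'n
  assumes "linear_code k C"
    and "0 < r" and "r \<le> k"
    and "\<forall>j. gen_hamming_weight r C \<le> j \<and> j \<le> CARD('n) \<longrightarrow> one_design j (support_mset r j C)"
  shows "higher_jacobi r C {i} =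
           Const (1 / of_nat CARD('n)) * polarization (higher_weight_enumerator r C)"
proof -
  define n where "n = CARD('n)"
  define A where "A = higher_weight_count r C"
  define J where "J = higher_jacobi_count r C {i}"
  have n: "n > 0" by (simp add: n_def)
  note through = card_subcodes_through_place[OF assms(4), of _ i, folded n_def A_def]
  have J1: "n * J a 1 = Suc a * A (Suc a)" for a
    unfolding J_def higher_jacobi_count_singleton_1 by (rule through)
  have J0: "n * J a 0 = (n - a) * A a" for a
  proof -
    have "n * J a 0 + a * A a = n * A a"
      unfolding through[symmetric] distrib_left[symmetric]
      unfolding J_def A_def higher_jacobi_count_singleton_0 ..
    then show ?thesis unfolding diff_mult_distrib by linarith
  qed
  have "of_nat n * higher_jacobi r C {i} = (\<Sum>a = 0..n - 1.
      (of_nat (n * J a 0) * Var Iw + of_nat (n * J a 1) * Var Iz) * Var Ix ^ (n - 1 - a) * Var Iy ^ a)"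
    unfolding higher_jacobi_def sum_distrib_left J_def n_def
    by (intro sum.cong) (simp_all add: distrib_left distrib_right ac_simps)
  also have "\<dots> = polarization (higher_weight_enumerator r C)"
    unfolding J0 J1 unfolding polarization_higher_weight_enumerator n_def A_def ..
  finally have "Const (1 / of_nat n) * polarization (higher_weight_enumerator r C)
      = Const (1 / of_nat n) * of_nat n * higher_jacobi r C {i}"
    by (simp add: mult.assoc)
  also have "Const (1 / of_nat n) * of_nat n = 1"
    using n unfolding Const_def single_of_nat[symmetric] mult_single by simp
  finally show ?thesis by (simp add: n_def)
qed

end
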